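(* Let $k\ge 3$ and $p=1+k+k(k-1)/2+k(k-1)(k-2)/6$. In the $k$-dimensional Poisson regression model with second-order interactions, let $\boldsymbol{\beta}$ have $\beta_0=0$, $\beta_1=\dots=\beta_k=-1$, $\beta_{ij}=0$ for all $1\le i<j\le k$, and $\beta_{ij\ell}=0$ for all $1\le i<j<\ell\le k$. Let $\mathbf{x}_0=(0,\dots,0)$, $\mathbf{x}_i=2\mathbf{e}_i$ for $i=1,\dots,k$ (where $\mathbf{e}_i$ is the $i$-th unit vector), $\mathbf{x}_{ij}=\mathbf{x}_i+\mathbf{x}_j$ for $1\le i<j\le k$, and $\mathbf{x}_{ij\ell}=\mathbf{x}_i+\mathbf{x}_j+\mathbf{x}_\ell$ for $1\le i<j<\ell\le k$. Then the design which assigns equal weights $1/p$ to these $p$ settings is locally $D$-optimal at $\boldsymbol{\beta}$ on $\mathcal{X}=[0,\infty)^k$.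
   Context: In the $k$-dimensional Poisson regression model with second-order interactions, an observation at $\mathbf{x}=(x_1,\dots,x_k)$ is Poisson distributed with mean $\lambda(\mathbf{x})=\exp(\mathbf{f}(\mathbf{x})^\top\boldsymbol{\beta})$, where $\mathbf{f}(\mathbf{x})$ consists of $1$, all $x_j$, all $x_ix_j$ ($i<j$) and all $x_ix_jx_\ell$ ($i<j<\ell$), so $\mathbf{f}(\mathbf{x})^\top\boldsymbol{\beta}=\beta_0+\sum_j\beta_jx_j+\sum_{i<j}\beta_{ij}x_ix_j+\sum_{i<j<\ell}\beta_{ij\ell}x_ix_jx_\ell$. A design $\xi$ is a finite collection of distinct settings $\mathbf{x}_i\in\mathcal{X}$ with weights $w_i\ge0$ summing to $1$; its information matrix is $\mathbf{M}_{\boldsymbol{\beta}}(\xi)=\sum_i w_i\lambda(\mathbf{x}_i)\mathbf{f}(\mathbf{x}_i)\mathbf{f}(\mathbf{x}_i)^\top$. A design is locally $D$-optimal at $\boldsymbol{\beta}$ on $\mathcal{X}$ if it maximizes $\det\mathbf{M}_{\boldsymbol{\beta}}(\xi)$ over all designs on $\mathcal{X}$. *)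

theory Defs
  imports "HOL-Analysis.Analysis"
begin

text \<open>Coordinates of \<open>x \<in> \<real>^k\<close> are indexed by a finite type \<open>'n\<close> with \<open>k = CARD('n)\<close>.
  The regression functions \<open>f(x)\<close> are indexed by the subsets \<open>S\<close> of the coordinate
  set with at most 3 elements: \<open>f_S(x) = \<Prod>i\<in>S. x_i\<close> (i.e. 1, x_j, x_i x_j, x_i x_j x_l).\<close>

definition idx :: "'n::finite set set" where
  "idx = {S. card S \<le> 3}"

definition regf :: "real^'n::finite \<Rightarrow> 'n set \<Rightarrow> real" where
  "regf x S = (\<Prod>i\<in>S. x $ i)"

definition intensity :: "('n::finite set \<Rightarrow> real) \<Rightarrow> real^'n \<Rightarrow> real" where
  "intensity \<beta> x = exp (\<Sum>S\<in>idx. regf x S * \<beta> S)"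

definition is_design :: "(real^'n::finite) set \<Rightarrow> (real^'n) set \<Rightarrow> (real^'n \<Rightarrow> real) \<Rightarrow> bool" where
  "is_design X D w \<longleftrightarrow> finite D \<and> D \<noteq> {} \<and> D \<subseteq> X \<and> (\<forall>x\<in>D. w x \<ge> 0) \<and> (\<Sum>x\<in>D. w x) = 1"

definition info_matrix ::
  "('n::finite set \<Rightarrow> real) \<Rightarrow> (real^'n) set \<Rightarrow> (real^'n \<Rightarrow> real) \<Rightarrow> 'n set \<Rightarrow> 'n set \<Rightarrow> real" where
  "info_matrix \<beta> D w S T = (\<Sum>x\<in>D. w x * intensity \<beta> x * regf x S * regf x T)"

definition det_on :: "'a set \<Rightarrow> ('a \<Rightarrow> 'a \<Rightarrow> real) \<Rightarrow> real" where
  "det_on I A = (\<Sum>\<sigma>\<in>{\<sigma>. \<sigma> permutes I}. of_int (sign \<sigma>) * (\<Prod>i\<in>I. A i (\<sigma> i)))"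

definition locally_D_optimal ::
  "('n::finite set \<Rightarrow> real) \<Rightarrow> (real^'n) set \<Rightarrow> (real^'n) set \<Rightarrow> (real^'n \<Rightarrow> real) \<Rightarrow> bool" where
  "locally_D_optimal \<beta> X D w \<longleftrightarrow> is_design X D w \<and>
     (\<forall>D' w'. is_design X D' w' \<longrightarrow>
        det_on idx (info_matrix \<beta> D' w') \<le> det_on idx (info_matrix \<beta> D w))"

end

theory Submission
  imports Defs
begin

text \<open>
  Write \<open>x = 2 t\<close> and let \<open>\<ell>\<^sub>S\<close> be the interpolation polynomials for the \<open>p\<close> support points. In the
  basis \<open>\<ell>\<^sub>S\<close> the information matrix of the proposed design is diagonal, so Hadamard's inequality and the
  inequality between arithmetic and geometric means reduce optimality to
  \<open>G(t) = \<Sum>S. e\<^bsup>2|S|\<^esup> \<ell>\<^sub>S(t)\<^sup>2 \<le> exp (2 \<Sum>i. t\<^sub>i)\<close> for \<open>t \<ge> 0\<close>.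

  Every \<open>\<ell>\<^sub>S\<close> is affine in each coordinate and \<open>G\<close> is symmetric. Hence on a segment \<open>t\<^sub>i = c + z\<close>,
  \<open>t\<^sub>j = c - z\<close> it is a quadratic polynomial in \<open>z\<^sup>2\<close> with nonnegative leading coefficient, and its maximum
  under \<open>\<Sum>i. t\<^sub>i = s\<close> is attained at a point whose nonzero coordinates, say \<open>m\<close> of them, all equal
  some \<open>a\<close>. For \<open>m \<le> 3\<close> the inequality is a power of \<open>(1 - a)\<^sup>2 + e\<^sup>2 a\<^sup>2 \<le> e\<^bsup>2a\<^esup>\<close>; for \<open>m \<ge> 4\<close> it is strict
  enough to follow from a Taylor polynomial of the exponential function.
\<close>

subsection \<open>Hadamard's inequality\<close>

definition psd :: "real^'n^'n \<Rightarrow> bool" where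
  "psd A \<longleftrightarrow> transpose A = A \<and> (\<forall>v. v \<bullet> (A *v v) \<ge> 0)"

lemma psd_sym: "psd A \<Longrightarrow> A $ i $ j = A $ j $ i"
  unfolding psd_def transpose_def by (metis vec_lambda_beta)

lemma psd_quadratic:
  fixes A :: "real^'n^'n"
  assumes "psd A"
  shows "(\<Sum>i\<in>UNIV. \<Sum>j\<in>UNIV. v i * A $ i $ j * v j) \<ge> 0"
proof -
  have "(\<chi> i. v i) \<bullet> (A *v (\<chi> i. v i)) = (\<Sum>i\<in>UNIV. \<Sum>j\<in>UNIV. v i * A $ i $ j * v j)"
    by (simp add: inner_vec_def matrix_vector_mult_def sum_distrib_left mult.assoc)
  then show ?thesis using assms unfolding psd_def by metis
qed

lemma psd_diag_nonneg:
  assumes "psd A"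
  shows "A $ i $ i \<ge> 0"
  using psd_quadratic[OF assms, of "\<lambda>k. if k = i then 1 else 0"]
  by (simp add: if_distrib[of "\<lambda>x. x * _"] if_distrib[of "\<lambda>x. _ * x"] sum.delta cong: if_cong)

text \<open>With a zero at position (i, i), the quadratic form at t e_i + e_j is affine in t with
  slope 2 A_ij, so it can stay nonnegative only if A_ij = 0.\<close>

lemma psd_zero_diag_imp_zero_row:
  fixes A :: "real^'n^'n"
  assumes "psd A" "A $ i $ i = 0"
  shows "A $ i $ j = 0"
proof (rule ccontr)
  assume nz: "A $ i $ j \<noteq> 0"
  with assms have ij: "i \<noteq> j" by auto
  define b where "b = A $ i $ j"
  \<comment> \<open>Chosen so that the form takes the value -1.\<close>
  define t where "t = - (A $ j $ j + 1) / (2 * b)"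
  define v where "v = (\<lambda>k. if k = i then t else if k = j then 1 else (0::real))"
  have v: "(\<Sum>k\<in>UNIV. v k * f k) = t * f i + f j" for f
  proof -
    have "(\<Sum>k\<in>UNIV. v k * f k) = (\<Sum>k\<in>{i,j}. v k * f k)"
      by (rule sum.mono_neutral_right) (auto simp: v_def)
    then show ?thesis using ij by (simp add: v_def)
  qed
  have "(\<Sum>k\<in>UNIV. \<Sum>l\<in>UNIV. v k * A $ k $ l * v l) = (\<Sum>k\<in>UNIV. v k * (\<Sum>l\<in>UNIV. v l * A $ k $ l))"
    by (simp add: sum_distrib_left mult_ac)
  also have "\<dots> = A $ j $ j + 2 * t * b"
    using assms(2) psd_sym[OF assms(1), of j i] by (simp add: v b_def)
  also have "\<dots> = -1" using nz by (simp add: t_def b_def field_simps)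
  finally show False using psd_quadratic[OF assms(1), of v] by simp
qed

text \<open>The matrix of one elimination step. Its transpose arises from the identity by adding a
  combination of the other rows to row a, which keeps the determinant.\<close>

lemma det_shear:
  fixes c :: "'n::finite \<Rightarrow> real"
  shows "det (\<chi> i j. (if i = j then 1 else 0) - (if j = a \<and> i \<noteq> a then c i else 0)) = (1::real)"
    (is "det ?E = 1")
proof -
  define x :: "real^'n" where "x = (\<chi> i. if i = a then 0 else - c i)"
  have row: "row k (mat 1 :: real^'n^'n) = axis k 1" for k
    by (simp add: row_def mat_def axis_def vec_eq_iff)
  have "x = (\<Sum>i\<in>UNIV. x $ i *s axis i 1)"
    by (simp add: basis_expansion)
  also have "\<dots> \<in> vec.span {row j (mat 1 :: real^'n^'n) |j. j \<noteq> a}"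
  proof (rule vec.span_sum)
    fix i :: 'n
    show "x $ i *s axis i 1 \<in> vec.span {row j (mat 1 :: real^'n^'n) |j. j \<noteq> a}"
    proof (cases "i = a")
      case False
      then have "axis i 1 \<in> {row j (mat 1 :: real^'n^'n) |j. j \<noteq> a}" by (auto simp: row)
      then show ?thesis by (intro vec.span_scale vec.span_base)
    qed (simp add: x_def vec.span_zero)
  qed
  finally have "det (\<chi> k. if k = a then row a (mat 1) + x else row k (mat 1)) = det (mat 1 :: real^'n^'n)"
    by (rule det_row_span)
  also have "(\<chi> k. if k = a then row a (mat 1) + x else row k (mat 1)) = transpose ?E"
    by (auto simp: vec_eq_iff transpose_def row axis_def x_def)
  finally show ?thesis by simp
qed

text \<open>Gaussian elimination by congruence: \<open>K\<close> contains the indices whose rows may still have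
  off-diagonal entries. Each step keeps the determinant and can only decrease the diagonal.\<close>

lemma hadamard_ineq_aux:
  fixes A :: "real^'n^'n"
  assumes "finite K" "psd A" "\<And>i j. i \<noteq> j \<Longrightarrow> A $ i $ j \<noteq> 0 \<Longrightarrow> i \<in> K"
  shows "det A \<le> (\<Prod>i\<in>UNIV. A $ i $ i)"
  using assms
proof (induction K arbitrary: A rule: finite_induct)
  case empty
  then show ?case by (subst det_diagonal) auto
next
  case (insert a K)
  show ?case
  proof (cases "A $ a $ a = 0")
    case True
    then have "row a A = 0"
      using psd_zero_diag_imp_zero_row[OF insert.prems(1)] by (simp add: row_def vec_eq_iff)
    then have "det A = 0"
      by (rule det_zero_row(2))
    moreover have "(\<Prod>i\<in>UNIV. A $ i $ i) = 0"
      using True by (intro prod_zero) auto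
    ultimately show ?thesis by linarith
  next
    case False
    then have pos: "A $ a $ a > 0"
      using psd_diag_nonneg[OF insert.prems(1), of a] by simp
    note sym = psd_sym[OF insert.prems(1)]
    define c where "c = (\<lambda>i. A $ i $ a / A $ a $ a)"
    define E :: "real^'n^'n" where
      "E = (\<chi> i j. (if i = j then 1 else 0) - (if j = a \<and> i \<noteq> a then c i else 0))"
    define B where "B = E ** A ** transpose E"
    have detE: "det E = 1"
      unfolding E_def by (rule det_shear)
    have EX: "(E ** X) $ i $ j = X $ i $ j - (if i = a then 0 else c i * X $ a $ j)" for X :: "real^'n^'n" and i j
    proof -
      have "(E ** X) $ i $ j = (\<Sum>k\<in>UNIV. (if i = k then X $ k $ j else 0)
             - (if k = a then (if i \<noteq> a then c i * X $ k $ j else 0) else 0))"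
        unfolding matrix_matrix_mult_def E_def by (auto intro!: sum.cong simp: algebra_simps)
      then show ?thesis by (simp add: sum_subtractf)
    qed
    have XE: "(X ** transpose E) $ i $ j = X $ i $ j - (if j = a then 0 else c j * X $ i $ a)" for X :: "real^'n^'n" and i j
    proof -
      have "X ** transpose E = transpose (E ** transpose X)"
        by (simp add: matrix_transpose_mul)
      then show ?thesis by (simp add: EX) (simp add: transpose_def EX)
    qed
    \<comment> \<open>The congruence clears row and column a except for the pivot; the remaining
      block is the Schur complement of the pivot.\<close>
    have B: "B $ i $ j = (if i = a \<or> j = a then if i = j then A $ a $ a else 0
                          else A $ i $ j - A $ i $ a * A $ a $ j / A $ a $ a)" for i j
      using pos sym[of a j] by (simp add: B_def XE EX c_def)
    have "psd B"
      unfolding psd_def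
    proof (intro conjI allI)
      show "transpose B = B"
        using sym by (auto simp: transpose_def vec_eq_iff B mult.commute)
      fix v
      have "v \<bullet> (B *v v) = (transpose E *v v) \<bullet> (A *v (transpose E *v v))"
        unfolding B_def
        by (metis dot_lmul_matrix matrix_vector_mul_assoc transpose_matrix_vector transpose_transpose matrix_mul_assoc)
      then show "v \<bullet> (B *v v) \<ge> 0"
        using insert.prems(1) unfolding psd_def by simp
    qed
    \<comment> \<open>An entry that is nonzero after elimination requires A_ij or A_ia to be nonzero
      before it. Either puts i into \<open>insert a K\<close>, and row a itself is now
      diagonal.\<close>
    moreover have "i \<in> K" if "i \<noteq> j" "B $ i $ j \<noteq> 0" for i j
      using that insert.prems(2)[of i j] insert.prems(2)[of i a]
      by (cases "A $ i $ a = 0") (auto simp: B split: if_splits)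
    ultimately have "det B \<le> (\<Prod>i\<in>UNIV. B $ i $ i)"
      by (rule insert.IH)
    also have "\<dots> \<le> (\<Prod>i\<in>UNIV. A $ i $ i)"
    proof (rule prod_mono)
      fix i
      have "A $ i $ a * A $ a $ i / A $ a $ a \<ge> 0"
        using pos sym[of i a] by simp
      then show "0 \<le> B $ i $ i \<and> B $ i $ i \<le> A $ i $ i"
        using psd_diag_nonneg[OF \<open>psd B\<close>, of i] by (auto simp: B)
    qed
    also have "det B = det A"
      by (simp add: B_def det_mul detE)
    finally show ?thesis .
  qed
qed

lemma hadamard_ineq:
  fixes A :: "real^'n^'n"
  assumes "psd A"
  shows "det A \<le> (\<Prod>i\<in>UNIV. A $ i $ i)"
  by (rule hadamard_ineq_aux[OF finite_class.finite_UNIV assms]) simp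

text \<open>\<open>det_on\<close> lives on a subset of the index type, whereas the library determinant needs
  the whole type; padding with the identity matrix mediates between the two.\<close>

definition pad :: "'a set \<Rightarrow> ('a \<Rightarrow> 'a \<Rightarrow> real) \<Rightarrow> real^'a^'a::finite" where
  "pad I A = (\<chi> i j. if i \<in> I \<and> j \<in> I then A i j else if i = j then 1 else 0)"

text \<open>A permutation moving a point outside I meets a zero entry of the padding, so only the
  permutations of I contribute.\<close>

lemma det_pad: "det (pad I A) = det_on I A"
proof -
  have "det (pad I A) = (\<Sum>p\<in>{p. p permutes I}. of_int (sign p) * (\<Prod>i\<in>UNIV. pad I A $ i $ p i))"
    unfolding det_def
  proof (rule sum.mono_neutral_right)
    show "{p. p permutes I} \<subseteq> {p. p permutes UNIV}"
      using permutes_subset by blast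
    show "\<forall>p\<in>{p. p permutes UNIV} - {p. p permutes I}.
        of_int (sign p) * (\<Prod>i\<in>UNIV. pad I A $ i $ p i) = 0"
    proof
      fix p assume "p \<in> {p. p permutes (UNIV :: 'a set)} - {p. p permutes I}"
      then obtain i where "i \<notin> I" "p i \<noteq> i"
        by (auto simp: permutes_def)
      then have "pad I A $ i $ p i = 0" by (simp add: pad_def)
      then show "of_int (sign p) * (\<Prod>i\<in>UNIV. pad I A $ i $ p i) = 0"
        by auto
    qed
  qed simp
  also have "\<dots> = det_on I A"
    unfolding det_on_def
  proof (intro sum.cong refl arg_cong2[where f = "(*)"])
    fix p assume "p \<in> {p. p permutes I}"
    then have p: "p permutes I" by simp
    have "(\<Prod>i\<in>UNIV. pad I A $ i $ p i) = (\<Prod>i\<in>I. pad I A $ i $ p i)"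
      by (rule prod.mono_neutral_right) (auto simp: pad_def permutes_not_in[OF p])
    also have "\<dots> = (\<Prod>i\<in>I. A i (p i))"
      by (rule prod.cong) (auto simp: pad_def permutes_in_image[OF p])
    finally show "(\<Prod>i\<in>UNIV. pad I A $ i $ p i) = (\<Prod>i\<in>I. A i (p i))" .
  qed
  finally show ?thesis .
qed

text \<open>The padded matrix is block diagonal with an identity block, and such matrices multiply
  blockwise.\<close>

lemma pad_mult: "pad I A ** pad I B = pad I (\<lambda>i j. \<Sum>k\<in>I. A i k * B k j)"
proof -
  have "(\<Sum>k\<in>UNIV. pad I A $ i $ k * pad I B $ k $ j) = pad I (\<lambda>i j. \<Sum>k\<in>I. A i k * B k j) $ i $ j" for i j
  proof (cases "i \<in> I")
    case True
    have "(\<Sum>k\<in>UNIV. pad I A $ i $ k * pad I B $ k $ j) = (\<Sum>k\<in>I. pad I A $ i $ k * pad I B $ k $ j)"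
      by (rule sum.mono_neutral_right) (use True in \<open>auto simp: pad_def\<close>)
    also have "\<dots> = pad I (\<lambda>i j. \<Sum>k\<in>I. A i k * B k j) $ i $ j"
      using True by (cases "j \<in> I") (auto simp: pad_def intro!: sum.neutral)
    finally show ?thesis .
  next
    case False
    have "(\<Sum>k\<in>UNIV. pad I A $ i $ k * pad I B $ k $ j) = (\<Sum>k\<in>{i}. pad I A $ i $ k * pad I B $ k $ j)"
      by (rule sum.mono_neutral_right) (use False in \<open>auto simp: pad_def\<close>)
    then show ?thesis using False by (auto simp: pad_def)
  qed
  then show ?thesis by (simp add: matrix_matrix_mult_def vec_eq_iff)
qed

text \<open>Applied to every design with the same F, so the factor (det F)^2 is common to both sides
  of the comparison and only the matrices N have to be compared.\<close>

lemma det_on_congruence: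
  fixes I :: "'a::finite set"
  assumes "\<And>i j. i \<in> I \<Longrightarrow> j \<in> I \<Longrightarrow> M i j = (\<Sum>u\<in>I. \<Sum>v\<in>I. F u i * N u v * F v j)"
  shows "det_on I M = (det_on I F)^2 * det_on I N"
proof -
  have "pad I M = transpose (pad I F) ** (pad I N ** pad I F)"
  proof -
    have "transpose (pad I F) = pad I (\<lambda>i j. F j i)"
      by (auto simp: transpose_def pad_def vec_eq_iff)
    then show ?thesis
      using assms by (auto simp: pad_mult sum_distrib_left mult.assoc) (auto simp: pad_def vec_eq_iff)
  qed
  then have "det (pad I M) = det (pad I F) * (det (pad I N) * det (pad I F))"
    by (simp add: det_mul)
  then show ?thesis by (simp add: det_pad power2_eq_square)
qed

text \<open>Padding adds only the squares of the outside coordinates to the quadratic form and ones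
  to the diagonal, so Hadamard's inequality carries over.\<close>

lemma det_on_le_prod_diag:
  fixes I :: "'a::finite set"
  assumes sym: "\<And>i j. N i j = N j i"
    and nonneg: "\<And>v. (\<Sum>i\<in>I. \<Sum>j\<in>I. v i * N i j * v j) \<ge> 0"
  shows "det_on I N \<le> (\<Prod>i\<in>I. N i i)"
proof -
  have "psd (pad I N)"
    unfolding psd_def
  proof (intro conjI allI)
    show "transpose (pad I N) = pad I N"
      using sym by (auto simp: transpose_def pad_def vec_eq_iff)
    fix v :: "real^'a"
    have row: "v $ i * (pad I N *v v) $ i = (if i \<in> I then \<Sum>j\<in>I. v $ i * N i j * v $ j else (v $ i)^2)" for i
    proof (cases "i \<in> I")
      case True
      have "(pad I N *v v) $ i = (\<Sum>j\<in>I. pad I N $ i $ j * v $ j)"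
        unfolding matrix_vector_mult_def vec_lambda_beta
        by (rule sum.mono_neutral_right) (use True in \<open>auto simp: pad_def\<close>)
      then show ?thesis using True by (simp add: pad_def sum_distrib_left mult.assoc)
    next
      case False
      have "(pad I N *v v) $ i = (\<Sum>j\<in>{i}. pad I N $ i $ j * v $ j)"
        unfolding matrix_vector_mult_def vec_lambda_beta
        by (rule sum.mono_neutral_right) (use False in \<open>auto simp: pad_def\<close>)
      then show ?thesis using False by (simp add: pad_def power2_eq_square)
    qed
    have "v \<bullet> (pad I N *v v) = (\<Sum>i\<in>I. \<Sum>j\<in>I. v $ i * N i j * v $ j) + (\<Sum>i\<in>-I. (v $ i)^2)"
      unfolding inner_vec_def inner_real_def row
      by (simp add: sum.If_cases)
    then show "v \<bullet> (pad I N *v v) \<ge> 0"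
      using nonneg by (simp add: sum_nonneg)
  qed
  then have "det_on I N \<le> (\<Prod>i\<in>UNIV. pad I N $ i $ i)"
    using hadamard_ineq by (simp add: det_pad[symmetric])
  also have "\<dots> = (\<Prod>i\<in>I. pad I N $ i $ i)"
    by (rule prod.mono_neutral_right) (auto simp: pad_def)
  finally show ?thesis by (simp add: pad_def)
qed

lemma det_on_diagonal:
  fixes I :: "'a::finite set"
  assumes "\<And>i j. i \<in> I \<Longrightarrow> j \<in> I \<Longrightarrow> i \<noteq> j \<Longrightarrow> A i j = 0"
  shows "det_on I A = (\<Prod>i\<in>I. A i i)"
proof -
  have "det_on I A = (\<Prod>i\<in>UNIV. pad I A $ i $ i)"
    unfolding det_pad[symmetric] by (rule det_diagonal) (use assms in \<open>auto simp: pad_def\<close>)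
  also have "\<dots> = (\<Prod>i\<in>I. pad I A $ i $ i)"
    by (rule prod.mono_neutral_right) (auto simp: pad_def)
  finally show ?thesis by (simp add: pad_def)
qed

subsection \<open>The bound for equal coordinates\<close>

text \<open>For \<open>m \<ge> 4\<close> equal coordinates with sum \<open>s\<close>, the sensitivity bound times \<open>m\<^sup>5\<close>, with
  \<open>exp 2\<close> replaced by \<open>7.39\<close> and \<open>exp (2 * s)\<close> by its Taylor polynomial of degree 10.\<close>

lemma equal_coords_poly_ineq:
  fixes m s :: real
  assumes m: "m \<ge> 4" and s: "s \<ge> 0"
  defines "E \<equiv> 739 / 100"
  shows "m * (m^2 - m^2 * s + m * (m - 1) / 2 * s^2 - (m - 1) * (m - 2) / 6 * s^3)^2
       + E * (s^2 * (m^2 - m * (m - 1) * s + (m - 1) * (m - 2) / 2 * s^2)^2)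
       + E^2 * (((m - 1) / 2) * s^4 * (m - (m - 2) * s)^2)
       + E^3 * (((m - 1) * (m - 2) / 6) * s^6)
       \<le> m^5 * (1 + 2 * s + 2 * s^2 + 4/3 * s^3 + 2/3 * s^4 + 4/15 * s^5 + 4/45 * s^6
                + 8/315 * s^7 + 2/315 * s^8 + 4/2835 * s^9 + 4/14175 * s^10)"
    (is "?L \<le> ?R")
proof -
  \<comment> \<open>Written as a polynomial in \<open>j = m - 4\<close>, the difference of the two sides has coefficients \<open>c0, \<dots>, c5\<close>,
    each of which is nonnegative for \<open>s \<ge> 0\<close>.\<close>
  define j where "j = m - 4"
  have j: "j \<ge> 0" and mj: "m = 4 + j"
    using m by (auto simp: j_def)
  define q where "q = 1 + 2 * s + 2 * s^2 + 4/3 * s^3 + 2/3 * s^4 + 4/15 * s^5 + 4/45 * s^6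
      + 8/315 * s^7 + 2/315 * s^8 + 4/2835 * s^9 + 4/14175 * s^10"
  \<comment> \<open>The letters a, b, d, e belong to the summands with the powers 0, 1, 2, 3 of E;
    the digit is the power of j.\<close>
  define a0 where "a0 = 1024 - 2048 * s + 1792 * s^2 - 896 * s^3 + 272 * s^4 - 48 * s^5 + 4 * s^6"
  define a1 where "a1 = 1280 - 2560 * s + 2304 * s^2 - 3680/3 * s^3 + 1220/3 * s^4 - 80 * s^5 + 23/3 * s^6"
  define a2 where "a2 = 640 - 1280 * s + 1184 * s^2 - 2008/3 * s^3 + 721/3 * s^4 - 157/3 * s^5 + 52/9 * s^6"
  define a3 where "a3 = 160 - 320 * s + 304 * s^2 - 182 * s^3 + 281/4 * s^4 - 101/6 * s^5 + 77/36 * s^6"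
  define a4 where "a4 = 20 - 40 * s + 39 * s^2 - 74/3 * s^3 + 61/6 * s^4 - 8/3 * s^5 + 7/18 * s^6"
  define a5 where "a5 = 1 - 2 * s + 2 * s^2 - 4/3 * s^3 + 7/12 * s^4 - 1/6 * s^5 + 1/36 * s^6"
  define b0 where "b0 = 256 * s^2 - 384 * s^3 + 240 * s^4 - 72 * s^5 + 9 * s^6"
  define b1 where "b1 = 256 * s^2 - 416 * s^3 + 296 * s^4 - 102 * s^5 + 15 * s^6"
  define b2 where "b2 = 96 * s^2 - 168 * s^3 + 135 * s^4 - 53 * s^5 + 37/4 * s^6"
  define b3 where "b3 = 16 * s^2 - 30 * s^3 + 27 * s^4 - 12 * s^5 + 5/2 * s^6"
  define b4 where "b4 = s^2 - 2 * s^3 + 2 * s^4 - s^5 + 1/4 * s^6"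
  define d0 where "d0 = 24 * s^4 - 24 * s^5 + 6 * s^6"
  define d1 where "d1 = 20 * s^4 - 26 * s^5 + 8 * s^6"
  define d2 where "d2 = 11/2 * s^4 - 9 * s^5 + 7/2 * s^6"
  define d3 where "d3 = 1/2 * s^4 - s^5 + 1/2 * s^6"
  define e0 where "e0 = s^6"
  define e1 where "e1 = 5/6 * s^6"
  define e2 where "e2 = 1/6 * s^6"
  have t0: "m * (m^2 - m^2 * s + m * (m - 1) / 2 * s^2 - (m - 1) * (m - 2) / 6 * s^3)^2
      = a0 + a1 * j + a2 * j^2 + a3 * j^3 + a4 * j^4 + a5 * j^5"
    unfolding mj a0_def a1_def a2_def a3_def a4_def a5_def
    by (simp add: power2_eq_square power3_eq_cube power_numeral_reduce field_simps)
  have t1: "s^2 * (m^2 - m * (m - 1) * s + (m - 1) * (m - 2) / 2 * s^2)^2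
      = b0 + b1 * j + b2 * j^2 + b3 * j^3 + b4 * j^4"
    unfolding mj b0_def b1_def b2_def b3_def b4_def
    by (simp add: power2_eq_square power3_eq_cube power_numeral_reduce field_simps)
  have t2: "((m - 1) / 2) * s^4 * (m - (m - 2) * s)^2
      = d0 + d1 * j + d2 * j^2 + d3 * j^3"
    unfolding mj d0_def d1_def d2_def d3_def
    by (simp add: power2_eq_square power3_eq_cube power_numeral_reduce field_simps)
  have t3: "((m - 1) * (m - 2) / 6) * s^6
      = e0 + e1 * j + e2 * j^2"
    unfolding mj e0_def e1_def e2_def
    by (simp add: power2_eq_square power3_eq_cube power_numeral_reduce field_simps)
  have m5: "m^5 = 1024 + 1280 * j + 640 * j^2 + 160 * j^3 + 20 * j^4 + j^5"
    unfolding mj by (simp add: power_numeral_reduce field_simps)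
  \<comment> \<open>Tangent line inequalities at \<open>s = 5\<close>, \<open>7/2\<close>, \<open>18/5\<close>; the \<open>c\<^sub>k\<close> are nonnegative combinations of these and of powers of \<open>s\<close>.\<close>
  have "s * (s - 5)^2 \<ge> 0" "s^3 * (s - 7/2)^2 \<ge> 0" "s^5 * (s - 18/5)^2 \<ge> 0"
    "s^5 * ((s - 18/5)^2 * (s + 36/5)) \<ge> 0"
    "s^5 * ((s - 18/5)^2 * (s^2 + 36/5 * s + 972/25)) \<ge> 0"
    "s^8 * (s - 18/5)^2 \<ge> 0"
    using s by simp_all
  then have sq: "s^3 - 10 * s^2 + 25 * s \<ge> 0" "s^5 - 7 * s^4 + 49/4 * s^3 \<ge> 0"
    "s^7 - 36/5 * s^6 + 324/25 * s^5 \<ge> 0"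
    "s^8 - 972/25 * s^6 + 11664/125 * s^5 \<ge> 0"
    "s^9 - 23328/125 * s^6 + 314928/625 * s^5 \<ge> 0"
    "s^10 - 36/5 * s^9 + 324/25 * s^8 \<ge> 0"
    by (simp_all add: field_simps power2_eq_square power3_eq_cube power_numeral_reduce)
  have pos: "s \<ge> 0" "s^2 \<ge> 0" "s^3 \<ge> 0" "s^4 \<ge> 0" "s^5 \<ge> 0" "s^6 \<ge> 0" "s^7 \<ge> 0"
    "s^8 \<ge> 0" "s^9 \<ge> 0" "s^10 \<ge> 0"
    using s by simp_all
  \<comment> \<open>The decimal factors are the first three powers of 739/100.\<close>
  define c0 where "c0 = 1024 * q - a0 - 739/100 * b0 - 546121/10000 * d0 - 403583419/1000000 * e0"
  define c1 where "c1 = 1280 * q - a1 - 739/100 * b1 - 546121/10000 * d1 - 403583419/1000000 * e1"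
  define c2 where "c2 = 640 * q - a2 - 739/100 * b2 - 546121/10000 * d2 - 403583419/1000000 * e2"
  define c3 where "c3 = 160 * q - a3 - 739/100 * b3 - 546121/10000 * d3"
  define c4 where "c4 = 20 * q - a4 - 739/100 * b4"
  define c5 where "c5 = q - a5"
  have "c0 \<ge> 0"
    using sq pos q_def a0_def b0_def d0_def e0_def unfolding c0_def by linarith
  moreover have "c1 \<ge> 0"
    using sq pos q_def a1_def b1_def d1_def e1_def unfolding c1_def by linarith
  moreover have "c2 \<ge> 0"
    using sq pos q_def a2_def b2_def d2_def e2_def unfolding c2_def by linarith
  moreover have "c3 \<ge> 0"
    using sq pos q_def a3_def b3_def d3_def unfolding c3_def by linarith
  moreover have "c4 \<ge> 0"
    using sq(1-3) pos q_def a4_def b4_def unfolding c4_def by linarith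
  moreover have "c5 \<ge> 0"
    using pos q_def a5_def unfolding c5_def by linarith
  ultimately have "0 \<le> c0 + c1 * j + c2 * j^2 + c3 * j^3 + c4 * j^4 + c5 * j^5"
    using j by simp
  also have "\<dots> = ?R - ?L"
    unfolding t0 t1 t2 t3 m5 q_def[symmetric] c0_def c1_def c2_def c3_def c4_def c5_def E_def
    by (simp add: algebra_simps add_divide_distrib power2_eq_square power3_eq_cube)
  finally show ?thesis by simp
qed

section \<open>Bounds for the exponential function and the inequality for equal coordinates\<close>

lemma exp_ge_taylor:
  fixes x :: real
  assumes "x \<ge> 0"
  shows "(\<Sum>k<n. x ^ k / fact k) \<le> exp x"
proof -
  have "(\<lambda>k. x ^ k / fact k) sums exp x"
    using exp_converges[of x] by (simp add: field_simps)
  then have "summable (\<lambda>k. x ^ k / fact k)" "(\<Sum>k. x ^ k / fact k) = exp x"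
    by (auto simp: sums_iff)
  then show ?thesis
    using sum_le_suminf[of "\<lambda>k. x ^ k / fact k" "{..<n}"] assms by simp
qed

lemma exp_2_le: "exp (2::real) \<le> 739 / 100"
proof -
  have "exp (1::real) \<le> 2.7184"
    using e_approx_32 by (simp add: abs_if split: if_splits)
  then have "exp (1::real) * exp 1 \<le> 2.7184 * 2.7184"
    by (intro mult_mono) auto
  then show ?thesis
    by (simp add: exp_add[symmetric])
qed

text \<open>After division by exp (2a), the left side h has a derivative with zeros only at b = 2 /
  (1 + e^2) and at 1: h falls from h(0) = 1, rises from b to h(1) = 1 and falls again. Equality at 0
  and 1 reflects the support points.\<close>

lemma one_coord_bound:
  fixes a :: real
  assumes "a \<ge> 0"
  shows "(1 - a)^2 + exp 2 * a^2 \<le> exp (2 * a)"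
proof -
  define E :: real where "E = exp 2"
  define h where "h = (\<lambda>a. ((1 - a)^2 + E * a^2) * exp (-2 * a))"
  define b where "b = 2 / (1 + E)"
  have E: "E > 1" by (simp add: E_def)
  have b: "0 < b" "b < 1" "(1 + E) * b = 2" using E by (auto simp: b_def field_simps)
  have D: "(h has_real_derivative 2 * (1 - x) * ((1 + E) * x - 2) * exp (-2 * x)) (at x)" for x
    unfolding h_def by (rule derivative_eq_intros refl)+ (simp add: algebra_simps power2_eq_square)
  have *: "(1 + E) * x \<le> 2" if "x \<le> b" for x
    using mult_left_mono[OF that, of "1 + E"] E b by simp
  have **: "(1 + E) * x \<ge> 2" if "x \<ge> b" for x
    using mult_left_mono[OF that, of "1 + E"] E b by simp
  have h0: "h 0 = 1" by (simp add: h_def)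
  have h1: "h 1 = 1" by (simp add: h_def E_def exp_add[symmetric])
  have "h a \<le> 1"
  proof -
    consider "a \<le> b" | "b \<le> a" "a \<le> 1" | "a \<ge> 1" by linarith
    then show ?thesis
    proof cases
      case 1
      have "h a \<le> h 0"
      proof (rule DERIV_nonpos_imp_nonincreasing[OF assms])
        fix x assume "0 \<le> x" "x \<le> a"
        then have "2 * (1 - x) * ((1 + E) * x - 2) * exp (-2 * x) \<le> 0"
          using *[of x] 1 b by (intro mult_nonpos_nonneg mult_nonneg_nonpos) auto
        then show "\<exists>y. (h has_real_derivative y) (at x) \<and> y \<le> 0" using D by blast
      qed
      then show ?thesis by (simp add: h0)
    next
      case 2
      have "h a \<le> h 1"
      proof (rule DERIV_nonneg_imp_nondecreasing[OF 2(2)])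
        fix x assume "a \<le> x" "x \<le> 1"
        then have "2 * (1 - x) * ((1 + E) * x - 2) * exp (-2 * x) \<ge> 0"
          using **[of x] 2 by (intro mult_nonneg_nonneg) auto
        then show "\<exists>y. (h has_real_derivative y) (at x) \<and> 0 \<le> y" using D by blast
      qed
      then show ?thesis by (simp add: h1)
    next
      case 3
      have "h a \<le> h 1"
      proof (rule DERIV_nonpos_imp_nonincreasing[OF 3])
        fix x assume "1 \<le> x" "x \<le> a"
        then have "2 * (1 - x) * ((1 + E) * x - 2) * exp (-2 * x) \<le> 0"
          using **[of x] b by (intro mult_nonpos_nonneg[OF mult_nonpos_nonneg]) auto
        then show "\<exists>y. (h has_real_derivative y) (at x) \<and> y \<le> 0" using D by blast
      qed
      then show ?thesis by (simp add: h1)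
    qed
  qed
  then have "h a * exp (2 * a) \<le> 1 * exp (2 * a)"
    by (intro mult_right_mono) auto
  then show ?thesis
    by (simp add: h_def E_def mult.assoc exp_add[symmetric])
qed

lemma real_choose_2: "real (n choose 2) = real n * (real n - 1) / 2"
  by (simp add: binomial_gbinomial numeral_2_eq_2 gbinomial_prod_rev field_simps)

lemma real_choose_3: "real (n choose 3) = real n * (real n - 1) * (real n - 2) / 6"
  by (simp add: binomial_gbinomial numeral_3_eq_3 gbinomial_prod_rev lessThan_Suc field_simps)

text \<open>By \<open>sens_indicator\<close> below, the left side is \<open>sens\<close> at a point
  with m coordinates equal to a and the others 0.\<close>

lemma equal_coords_bound:
  fixes a :: real and m :: nat
  assumes a: "a \<ge> 0"
  shows "(\<Sum>r\<le>3. real (m choose r) * (exp 2 ^ r * (a ^ r *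
            (\<Sum>j\<le>3 - r. real ((m - r) choose j) * (- a) ^ j))^2)) \<le> exp (2 * (real m * a))"
    (is "?G \<le> _")
proof -
  define E :: real where "E = exp 2"
  have E: "E \<le> 739 / 100" "E \<ge> 0" using exp_2_le by (auto simp: E_def)
  have sums: "{..3::nat} = {0,1,2,3}" "{..2::nat} = {0,1,2}" "{..Suc 0} = {0, 1}" by auto
  show ?thesis
  proof (cases "m \<ge> 4")
    case True
    define M where "M = real m"
    define s where "s = M * a"
    have M: "M \<ge> 4" using True by (simp add: M_def)
    have s: "s \<ge> 0" using a M by (simp add: s_def)
    have sub: "real (m - Suc 0) = M - 1" "real (m - 2) = M - 2" "real (m - 3) = M - 3"
      using True by (auto simp: M_def)
    have G_eq: "?G = (1 - M * a + M * (M - 1) / 2 * a^2 - M * (M - 1) * (M - 2) / 6 * a^3)^2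
       + E * (M * a^2 * (1 - (M - 1) * a + (M - 1) * (M - 2) / 2 * a^2)^2)
       + E^2 * (M * (M - 1) / 2 * a^4 * (1 - (M - 2) * a)^2)
       + E^3 * (M * (M - 1) * (M - 2) / 6 * a^6)"
      by (simp add: sums E_def[symmetric] real_choose_2 real_choose_3 sub M_def[symmetric]
          power_mult_distrib power_mult[symmetric] field_simps)
        (simp add: power2_eq_square)
    \<comment> \<open>With a = s / M, the factor M^5 clears the denominators coming from powers of
      a.\<close>
    have "M^5 * ?G = M * (M^2 - M^2 * s + M * (M - 1) / 2 * s^2 - (M - 1) * (M - 2) / 6 * s^3)^2
       + E * (s^2 * (M^2 - M * (M - 1) * s + (M - 1) * (M - 2) / 2 * s^2)^2)
       + E^2 * (((M - 1) / 2) * s^4 * (M - (M - 2) * s)^2)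
       + E^3 * (((M - 1) * (M - 2) / 6) * s^6)"
      unfolding G_eq s_def by (simp add: power2_eq_square power3_eq_cube power_numeral_reduce field_simps)
    also have "\<dots> \<le> M * (M^2 - M^2 * s + M * (M - 1) / 2 * s^2 - (M - 1) * (M - 2) / 6 * s^3)^2
       + 739/100 * (s^2 * (M^2 - M * (M - 1) * s + (M - 1) * (M - 2) / 2 * s^2)^2)
       + (739/100)^2 * (((M - 1) / 2) * s^4 * (M - (M - 2) * s)^2)
       + (739/100)^3 * (((M - 1) * (M - 2) / 6) * s^6)"
      using E M s by (intro add_mono mult_right_mono power_mono order.refl) auto
    also note equal_coords_poly_ineq[OF M s]
    also have "1 + 2 * s + 2 * s^2 + 4/3 * s^3 + 2/3 * s^4 + 4/15 * s^5 + 4/45 * s^6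
                + 8/315 * s^7 + 2/315 * s^8 + 4/2835 * s^9 + 4/14175 * s^10
                = (\<Sum>k<11. (2 * s) ^ k / fact k)"
      by (simp add: eval_nat_numeral fact_numeral)
    also have "M^5 * \<dots> \<le> M^5 * exp (2 * s)"
      using exp_ge_taylor[of "2 * s" 11] s M by (intro mult_left_mono) auto
    finally show ?thesis using M by (simp add: s_def M_def)
  next
    case False
    then have "m \<in> {0,1,2,3}" by auto
    \<comment> \<open>For m at most 3 the bound on the subset sizes cuts nothing off: the inner sums
      are powers of 1 - a, and the binomial theorem applies.\<close>
    moreover have "?G = ((1 - a)^2 + E * a^2) ^ m" 
      using calculation
      by (elim insertE emptyE; simp add: sums E_def[symmetric] real_choose_2 real_choose_3)
       (simp_all add: binomial_eq_0 eval_nat_numeral algebra_simps)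
    moreover have "((1 - a)^2 + E * a^2) ^ m \<le> exp (2 * a) ^ m"
      using one_coord_bound[OF a] E by (intro power_mono) (auto simp: E_def)
    ultimately show ?thesis by (simp add: exp_of_nat_mult[symmetric] algebra_simps)
  qed
qed

subsection \<open>Interpolation polynomials and the sensitivity function\<close>

text \<open>In the coordinates \<open>t = x / 2\<close> the support points are the 0-1 vectors with at most three ones.
  \<open>lag S\<close> is the interpolation polynomial that is 1 at the indicator vector of \<open>S\<close> and 0 at the
  others; up to the factor \<open>exp (- 2 * (\<Sum>i. t $ i))\<close>, \<open>sens\<close> is the sensitivity function of the
  Kiefer-Wolfowitz equivalence theorem.\<close>

definition lag :: "'n::finite set \<Rightarrow> real^'n \<Rightarrow> real" where
  "lag S t = (\<Sum>T | T \<in> idx \<and> S \<subseteq> T. (-1) ^ card (T - S) * regf t T)"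

definition sens :: "real^'n::finite \<Rightarrow> real" where
  "sens t = (\<Sum>S\<in>idx. exp 2 ^ card S * (lag S t)^2)"

section \<open>Moebius inversion over subsets\<close>

lemma sum_Pow_minus_one_power_card:
  assumes "finite A"
  shows "(\<Sum>W\<in>Pow A. (-1) ^ card W) = (if A = {} then 1 else 0 :: real)"
proof -
  have "(\<Sum>W\<in>Pow A. (-1) ^ card W) = (\<Prod>x\<in>A. (-1) + (1::real))"
    by (subst prod_add[OF assms]) simp
  then show ?thesis using assms by (simp add: card_gt_0_iff)
qed

text \<open>Complementation in T carries the interval from S to T onto the power set of T - S, where
  the alternating sum is the expanded product of factors -1 + 1.\<close>

lemma sum_interval_minus_one_power_card:
  fixes S T :: "'a set"
  assumes "finite T"
  shows "(\<Sum>U | S \<subseteq> U \<and> U \<subseteq> T. (-1) ^ card (T - U)) = (if S = T then 1 else 0 :: real)"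
proof (cases "S \<subseteq> T")
  case True
  have "(\<Sum>U | S \<subseteq> U \<and> U \<subseteq> T. (-1) ^ card (T - U)) = (\<Sum>W\<in>Pow (T - S). (-1) ^ card W :: real)"
    by (rule sum.reindex_bij_witness[of _ "\<lambda>W. T - W" "\<lambda>U. T - U"])
      (use True in \<open>auto simp: double_diff\<close>)
  then show ?thesis
    using True assms by (auto simp: sum_Pow_minus_one_power_card)
next
  case False
  then have "{U. S \<subseteq> U \<and> U \<subseteq> T} = {}" "S \<noteq> T" by auto
  then show ?thesis by (simp only: sum.empty if_False)
qed

text \<open>Interpolation reproduces the regression functions: the coefficient of
  \<open>lag U\<close> is the value of the monomial of S at the indicator of U. Exchanging the sums
  leaves an alternating sum over an interval.\<close>

lemma regf_eq_sum_lag: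
  fixes t :: "real^'n::finite"
  assumes "S \<in> idx"
  shows "regf t S = (\<Sum>U\<in>idx. if S \<subseteq> U then lag U t else 0)"
proof -
  have "(\<Sum>U\<in>idx. if S \<subseteq> U then lag U t else 0) =
     (\<Sum>U\<in>idx. \<Sum>T\<in>idx. if S \<subseteq> U \<and> U \<subseteq> T then (-1) ^ card (T - U) * regf t T else 0)"
  proof (rule sum.cong[OF refl])
    fix U :: "'n set"
    show "(if S \<subseteq> U then lag U t else 0) =
        (\<Sum>T\<in>idx. if S \<subseteq> U \<and> U \<subseteq> T then (-1) ^ card (T - U) * regf t T else 0)"
      by (cases "S \<subseteq> U") (simp_all add: lag_def sum.inter_filter)
  qed
  also have "\<dots> = (\<Sum>T\<in>idx. \<Sum>U\<in>idx. if S \<subseteq> U \<and> U \<subseteq> T then (-1) ^ card (T - U) * regf t T else 0)"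
    by (rule sum.swap)
  also have "\<dots> = (\<Sum>T\<in>idx. if S = T then regf t T else 0)"
  proof (rule sum.cong[OF refl])
    fix T :: "'n set" assume T: "T \<in> idx"
    \<comment> \<open>\<open>idx\<close> is closed under subsets, so the interval below T lies
      inside it.\<close>
    then have "{U \<in> idx. S \<subseteq> U \<and> U \<subseteq> T} = {U. S \<subseteq> U \<and> U \<subseteq> T}"
      by (auto simp: idx_def intro: order_trans[OF card_mono[OF finite]])
    then have "(\<Sum>U\<in>idx. if S \<subseteq> U \<and> U \<subseteq> T then (-1) ^ card (T - U) * regf t T else 0)
        = (\<Sum>U | S \<subseteq> U \<and> U \<subseteq> T. (-1) ^ card (T - U) * regf t T)"
      by (simp add: sum.inter_filter[symmetric])
    then show "(\<Sum>U\<in>idx. if S \<subseteq> U \<and> U \<subseteq> T then (-1) ^ card (T - U) * regf t T else 0)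
        = (if S = T then regf t T else 0)"
      by (simp add: sum_distrib_right[symmetric] sum_interval_minus_one_power_card)
  qed
  also have "\<dots> = regf t S" using assms by simp
  finally show ?thesis by simp
qed

lemma sum_subsets_by_card:
  fixes g :: "nat \<Rightarrow> real"
  assumes "finite A"
  shows "(\<Sum>W | W \<subseteq> A \<and> card W \<le> n. g (card W)) = (\<Sum>j\<le>n. real (card A choose j) * g j)"
proof -
  have "(\<Sum>W | W \<subseteq> A \<and> card W \<le> n. g (card W))
      = (\<Sum>j\<le>n. \<Sum>W | W \<in> {W. W \<subseteq> A \<and> card W \<le> n} \<and> card W = j. g (card W))"
    by (rule sum.group[symmetric]) (use assms in auto)
  also have "\<dots> = (\<Sum>j\<le>n. real (card A choose j) * g j)"
  proof (rule sum.cong[OF refl])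
    fix j assume "j \<in> {..n}"
    then have "{W \<in> {W. W \<subseteq> A \<and> card W \<le> n}. card W = j} = {W. W \<subseteq> A \<and> card W = j}"
      by auto
    then show "(\<Sum>W | W \<in> {W. W \<subseteq> A \<and> card W \<le> n} \<and> card W = j. g (card W)) = real (card A choose j) * g j"
      by (simp add: n_subsets[OF assms])
  qed
  finally show ?thesis .
qed

section \<open>Values at points whose nonzero coordinates are equal\<close>

lemma regf_indicator:
  "regf (\<chi> i. if i \<in> A then a else 0) T = (if T \<subseteq> A then a ^ card T else 0)"
proof (cases "T \<subseteq> A")
  case True
  then have "regf (\<chi> i. if i \<in> A then a else 0) T = (\<Prod>i\<in>T. a)"
    unfolding regf_def by (intro prod.cong) auto
  with True show ?thesis by simp
qed (auto simp: regf_def intro!: prod_zero)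

text \<open>Only the sets T between S and A contribute. Writing T as S together with W, the size
  limit 3 for T becomes 3 - |S| for W, a true difference because S is in \<open>idx\<close>.\<close>

lemma lag_indicator:
  fixes A :: "'n::finite set"
  assumes "S \<in> idx"
  shows "lag S (\<chi> i. if i \<in> A then a else 0) = (if S \<subseteq> A then
     a ^ card S * (\<Sum>j\<le>3 - card S. real ((card A - card S) choose j) * (- a) ^ j) else 0)"
proof (cases "S \<subseteq> A")
  case True
  have "lag S (\<chi> i. if i \<in> A then a else 0)
      = (\<Sum>T | T \<in> idx \<and> S \<subseteq> T \<and> T \<subseteq> A. (-1) ^ card (T - S) * a ^ card T)"
    unfolding lag_def regf_indicator by (rule sum.mono_neutral_cong_right) auto
  also have "\<dots> = (\<Sum>W | W \<subseteq> A - S \<and> card W \<le> 3 - card S. a ^ card S * (- a) ^ card W)"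
  proof (rule sum.reindex_bij_witness[of _ "\<lambda>W. S \<union> W" "\<lambda>T. T - S"])
    fix T assume T: "T \<in> {T. T \<in> idx \<and> S \<subseteq> T \<and> T \<subseteq> A}"
    have c: "card T = card S + card (T - S)"
      using T card_mono[of T S] by (simp add: card_Diff_subset)
    then show "T - S \<in> {W. W \<subseteq> A - S \<and> card W \<le> 3 - card S}"
      using T by (auto simp: idx_def)
    have "(- a) ^ n = (-1) ^ n * a ^ n" for n by (metis mult_minus1 power_mult_distrib)
    then show "a ^ card S * (- a) ^ card (T - S) = (-1) ^ card (T - S) * a ^ card T"
      by (simp add: c power_add)
  next
    fix W assume W: "W \<in> {W. W \<subseteq> A - S \<and> card W \<le> 3 - card S}"
    then have "card (S \<union> W) = card S + card W"
      by (intro card_Un_disjoint) auto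
    then show "S \<union> W \<in> {T. T \<in> idx \<and> S \<subseteq> T \<and> T \<subseteq> A}"
      using W True assms by (auto simp: idx_def)
  qed auto
  also have "\<dots> = (\<Sum>j\<le>3 - card S. real (card (A - S) choose j) * (a ^ card S * (- a) ^ j))"
    by (rule sum_subsets_by_card) simp
  finally show ?thesis
    using True by (simp add: card_Diff_subset sum_distrib_left mult_ac)
next
  case False
  then have "lag S (\<chi> i. if i \<in> A then a else 0) = 0"
    unfolding lag_def regf_indicator by (intro sum.neutral) auto
  then show ?thesis using False by simp
qed

lemma sens_indicator:
  fixes A :: "'n::finite set"
  shows "sens (\<chi> i. if i \<in> A then a else 0) =
    (\<Sum>r\<le>3. real (card A choose r) * (exp 2 ^ r * (a ^ r *
            (\<Sum>j\<le>3 - r. real ((card A - r) choose j) * (- a) ^ j))^2))"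
proof -
  have "sens (\<chi> i. if i \<in> A then a else 0) = (\<Sum>S | S \<subseteq> A \<and> card S \<le> 3.
     exp 2 ^ card S * (a ^ card S * (\<Sum>j\<le>3 - card S. real ((card A - card S) choose j) * (- a) ^ j))^2)"
    unfolding sens_def
    by (rule sum.mono_neutral_cong_right) (auto simp: lag_indicator idx_def)
  also have "\<dots> = (\<Sum>r\<le>3. real (card A choose r) * (exp 2 ^ r * (a ^ r *
            (\<Sum>j\<le>3 - r. real ((card A - r) choose j) * (- a) ^ j))^2))"
    by (rule sum_subsets_by_card) simp
  finally show ?thesis .
qed

section \<open>Symmetry under permutations of the coordinates\<close>

lemma bij_betw_image_idx:
  fixes \<pi> :: "'n::finite \<Rightarrow> 'n"
  assumes "bij \<pi>"
  shows "bij_betw ((`) \<pi>) {T. T \<in> idx \<and> S \<subseteq> T} {T. T \<in> idx \<and> \<pi> ` S \<subseteq> T}"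
proof (rule bij_betwI[where g = "(`) (inv \<pi>)"])
  have "inj \<pi>" "inj (inv \<pi>)" using assms by (auto simp: bij_is_inj bij_imp_bij_inv)
  then have c: "card (\<pi> ` T) = card T" "card (inv \<pi> ` T) = card T" for T
    by (simp_all add: card_image inj_on_subset[OF _ subset_UNIV])
  show "(`) \<pi> \<in> {T. T \<in> idx \<and> S \<subseteq> T} \<rightarrow> {T. T \<in> idx \<and> \<pi> ` S \<subseteq> T}"
    by (auto simp: idx_def c)
  show "(`) (inv \<pi>) \<in> {T. T \<in> idx \<and> \<pi> ` S \<subseteq> T} \<rightarrow> {T. T \<in> idx \<and> S \<subseteq> T}"
    using \<open>inj \<pi>\<close> by (force simp: idx_def c image_iff)
qed (use assms in \<open>auto simp: image_image bij_is_inj bij_is_surj surj_f_inv_f image_iff\<close>)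

lemma regf_permute:
  assumes "bij \<pi>"
  shows "regf (\<chi> i. t $ \<pi> i) T = regf t (\<pi> ` T)"
  unfolding regf_def by (subst prod.reindex) (use assms in \<open>auto simp: bij_def intro: inj_on_subset\<close>)

lemma lag_permute:
  fixes \<pi> :: "'n::finite \<Rightarrow> 'n"
  assumes "bij \<pi>"
  shows "lag S (\<chi> i. t $ \<pi> i) = lag (\<pi> ` S) t"
proof -
  have inj: "inj \<pi>" using assms by (rule bij_is_inj)
  have "lag (\<pi> ` S) t = (\<Sum>T | T \<in> idx \<and> S \<subseteq> T. (-1) ^ card (\<pi> ` T - \<pi> ` S) * regf t (\<pi> ` T))"
    unfolding lag_def by (rule sum.reindex_bij_betw[OF bij_betw_image_idx[OF assms], symmetric])
  also have "\<dots> = lag S (\<chi> i. t $ \<pi> i)"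
    unfolding lag_def regf_permute[OF assms]
    by (simp add: image_set_diff[OF inj, symmetric] card_image inj_on_subset[OF inj])
  finally show ?thesis by simp
qed

lemma sens_permute:
  fixes \<pi> :: "'n::finite \<Rightarrow> 'n"
  assumes "bij \<pi>"
  shows "sens (\<chi> i. t $ \<pi> i) = sens t"
proof -
  have inj: "inj \<pi>" using assms by (rule bij_is_inj)
  have "bij_betw ((`) \<pi>) idx idx"
    using bij_betw_image_idx[OF assms, of "{}"] by simp
  then have "sens t = (\<Sum>S\<in>idx. exp 2 ^ card (\<pi> ` S) * (lag (\<pi> ` S) t)^2)"
    unfolding sens_def by (rule sum.reindex_bij_betw[symmetric])
  also have "\<dots> = sens (\<chi> i. t $ \<pi> i)"
    by (simp add: sens_def lag_permute[OF assms] card_image inj_on_subset[OF inj])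
  finally show ?thesis by simp
qed

section \<open>Segments that exchange mass between two coordinates\<close>

definition seg :: "real^'n \<Rightarrow> 'n \<Rightarrow> 'n \<Rightarrow> real \<Rightarrow> real \<Rightarrow> real^'n" where
  "seg t i j c z = (\<chi> k. if k = i then c + z else if k = j then c - z else t $ k)"

text \<open>The monomials are squarefree, so at most the two affine factors c + z and c - z depend
  on z.\<close>

lemma regf_seg_quadratic:
  fixes t :: "real^'n::finite"
  assumes "i \<noteq> j"
  shows "\<exists>\<alpha> \<beta> \<gamma>. \<forall>z. regf (seg t i j c z) T = \<alpha> + \<beta> * z + \<gamma> * z^2"
proof -
  define P where "P = (\<Prod>k\<in>T - {i, j}. t $ k)"
  have "regf (seg t i j c z) T = (\<Prod>k\<in>T \<inter> {i, j}. seg t i j c z $ k) * (\<Prod>k\<in>T - {i, j}. seg t i j c z $ k)" for z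
    unfolding regf_def by (subst prod.union_disjoint[symmetric]) (auto intro: prod.cong)
  also have "(\<Prod>k\<in>T - {i, j}. seg t i j c z $ k) = P" for z
    unfolding P_def by (rule prod.cong) (auto simp: seg_def)
  finally have *: "regf (seg t i j c z) T = (\<Prod>k\<in>T \<inter> {i, j}. seg t i j c z $ k) * P" for z .
  consider "T \<inter> {i, j} = {}" | "T \<inter> {i, j} = {i}" | "T \<inter> {i, j} = {j}" | "T \<inter> {i, j} = {i, j}"
    by blast
  then show ?thesis
  proof cases
    case 1
    have "regf (seg t i j c z) T = P + 0 * z + 0 * z^2" for z unfolding * 1 by simp
    then show ?thesis by blast
  next
    case 2
    have "regf (seg t i j c z) T = c * P + P * z + 0 * z^2" for z
      unfolding * 2 by (simp add: seg_def algebra_simps)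
    then show ?thesis by blast
  next
    case 3
    have "regf (seg t i j c z) T = c * P + (- P) * z + 0 * z^2" for z
      unfolding * 3 using assms by (simp add: seg_def algebra_simps)
    then show ?thesis by blast
  next
    case 4
    have "regf (seg t i j c z) T = c^2 * P + 0 * z + (- P) * z^2" for z
      unfolding * 4 using assms by (simp add: seg_def algebra_simps power2_eq_square)
    then show ?thesis by blast
  qed
qed

lemma lag_seg_quadratic:
  fixes t :: "real^'n::finite"
  assumes "i \<noteq> j"
  shows "\<exists>\<alpha> \<beta> \<gamma>. \<forall>z. lag S (seg t i j c z) = \<alpha> + \<beta> * z + \<gamma> * z^2"
proof -
  obtain \<alpha> \<beta> \<gamma> where *: "\<And>T z. regf (seg t i j c z) T = \<alpha> T + \<beta> T * z + \<gamma> T * z^2"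
    using regf_seg_quadratic[OF assms, of t c] by metis
  let ?s = "\<lambda>T. (-1) ^ card (T - S) :: real"
  have "lag S (seg t i j c z) = (\<Sum>T | T \<in> idx \<and> S \<subseteq> T. ?s T * \<alpha> T)
     + (\<Sum>T | T \<in> idx \<and> S \<subseteq> T. ?s T * \<beta> T) * z + (\<Sum>T | T \<in> idx \<and> S \<subseteq> T. ?s T * \<gamma> T) * z^2" for z
    unfolding lag_def * sum_distrib_right sum.distrib[symmetric]
    by (rule sum.cong) (auto simp: algebra_simps)
  then show ?thesis by blast
qed

text \<open>Replacing z by -z swaps coordinates i and j, so by symmetry only even powers survive.
  The coefficient of z^4 is a positively weighted sum of squares.\<close>

lemma sens_seg:
  fixes t :: "real^'n::finite"
  assumes "i \<noteq> j"
  shows "\<exists>p q r. r \<ge> 0 \<and> (\<forall>z. sens (seg t i j c z) = p + q * z^2 + r * z^4)"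
proof -
  obtain \<alpha> \<beta> \<gamma> where *: "\<And>S z. lag S (seg t i j c z) = \<alpha> S + \<beta> S * z + \<gamma> S * z^2"
    using lag_seg_quadratic[OF assms, of _ t c] by metis
  have sym: "sens (seg t i j c (- z)) = sens (seg t i j c z)" for z
  proof -
    have "seg t i j c (- z) = (\<chi> k. seg t i j c z $ Transposition.transpose i j k)"
      using assms by (auto simp: seg_def vec_eq_iff Transposition.transpose_def)
    then show ?thesis by (simp add: sens_permute)
  qed
  let ?w = "\<lambda>S :: 'n set. exp 2 ^ card S :: real"
  have "sens (seg t i j c z) = (\<Sum>S\<in>idx. ?w S * (\<alpha> S)^2) + (\<Sum>S\<in>idx. ?w S * ((\<beta> S)^2 + 2 * \<alpha> S * \<gamma> S)) * z^2
          + (\<Sum>S\<in>idx. ?w S * (\<gamma> S)^2) * z^4" for z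
  proof -
    have "2 * sens (seg t i j c z) = sens (seg t i j c z) + sens (seg t i j c (- z))"
      by (simp add: sym)
    also have "\<dots> = 2 * ((\<Sum>S\<in>idx. ?w S * (\<alpha> S)^2) + (\<Sum>S\<in>idx. ?w S * ((\<beta> S)^2 + 2 * \<alpha> S * \<gamma> S)) * z^2
          + (\<Sum>S\<in>idx. ?w S * (\<gamma> S)^2) * z^4)"
      unfolding sens_def * sum_distrib_right sum_distrib_left sum.distrib[symmetric]
      by (rule sum.cong) (auto simp: algebra_simps power2_eq_square power4_eq_xxxx)
    finally show ?thesis by simp
  qed
  moreover have "(\<Sum>S\<in>idx. ?w S * (\<gamma> S)^2) \<ge> 0"
    by (intro sum_nonneg) auto
  ultimately show ?thesis by blast
qed

text \<open>Used with w = z^2 and C = c^2: a convex function on [0, C] that is at w at least as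
  large as at both ends is constant.\<close>

lemma convex_quadratic_interior_max:
  fixes p q r w C :: real
  assumes "r \<ge> 0" "0 < w" "w < C"
    and "p \<le> p + q * w + r * w^2" "p + q * C + r * C^2 \<le> p + q * w + r * w^2"
  shows "p + q * w + r * w^2 = p"
proof -
  have "0 \<le> w * (q + r * w)" using assms(4) by (simp add: algebra_simps power2_eq_square)
  then have 1: "q + r * w \<ge> 0" using assms(2) by (simp add: zero_le_mult_iff)
  have "(C - w) * (q + r * (w + C)) \<le> 0" using assms(5) by (simp add: algebra_simps power2_eq_square)
  then have 2: "q + r * (w + C) \<le> 0" using assms(3) by (simp add: mult_le_0_iff)
  have "r * C \<le> 0" using 1 2 by (simp add: algebra_simps)
  then have "r = 0" using assms by (simp add: mult_le_0_iff)
  with 1 2 show ?thesis by simp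
qed

section \<open>Maximization over the simplex\<close>

lemma continuous_on_sens: "continuous_on X (sens :: real^'n::finite \<Rightarrow> real)"
  unfolding sens_def lag_def regf_def by (intro continuous_intros)

lemma compact_simplex: "compact {u :: real^'n::finite. (\<forall>i. u $ i \<ge> 0) \<and> (\<Sum>i\<in>UNIV. u $ i) = s}"
proof -
  have "norm u \<le> s" if "\<forall>i. u $ i \<ge> 0" "(\<Sum>i\<in>UNIV. u $ i) = s" for u :: "real^'n"
    using norm_le_l1_cart[of u] that by simp
  then have "bounded {u :: real^'n. (\<forall>i. u $ i \<ge> 0) \<and> (\<Sum>i\<in>UNIV. u $ i) = s}"
    unfolding bounded_iff by blast
  moreover have "closed {u :: real^'n. (\<forall>i. u $ i \<ge> 0) \<and> (\<Sum>i\<in>UNIV. u $ i) = s}"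
    by (intro closed_Collect_conj closed_Collect_all closed_Collect_le closed_Collect_eq continuous_intros)
  ultimately show ?thesis by (simp add: compact_eq_bounded_closed)
qed

lemma sum_two_change:
  fixes f g :: "'a::finite \<Rightarrow> real"
  assumes "i \<noteq> j" "\<And>k. k \<noteq> i \<Longrightarrow> k \<noteq> j \<Longrightarrow> f k = g k"
  shows "sum f UNIV = sum g UNIV + (f i + f j - g i - g j)"
proof -
  have "sum h UNIV = h i + h j + sum h (UNIV - {i} - {j})" for h :: "'a \<Rightarrow> real"
    using assms(1) by (simp add: sum.remove[of UNIV i] sum.remove[of "UNIV - {i}" j])
  moreover have "sum f (UNIV - {i} - {j}) = sum g (UNIV - {i} - {j})"
    using assms(2) by (intro sum.cong) auto
  ultimately show ?thesis by simp
qed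

text \<open>Among the maximizers of \<open>sens\<close> on the simplex take one of minimal norm: two different positive
  coordinates would be an interior point of a segment on which \<open>sens\<close> is a convex function of
  \<open>z\<^sup>2\<close>, hence constant, and averaging them would decrease the norm.\<close>

lemma sens_max_equal_coords:
  fixes t :: "real^'n::finite"
  assumes t: "\<And>i. t $ i \<ge> 0"
  obtains A :: "'n set" and a where "a \<ge> 0" "real (card A) * a = (\<Sum>i\<in>UNIV. t $ i)"
    "sens t \<le> sens (\<chi> i. if i \<in> A then a else 0)"
proof -
  define s where "s = (\<Sum>i\<in>UNIV. t $ i)"
  define K where "K = {u :: real^'n. (\<forall>i. u $ i \<ge> 0) \<and> (\<Sum>i\<in>UNIV. u $ i) = s}"
  have K: "compact K" unfolding K_def by (rule compact_simplex)
  have tK: "t \<in> K" using t by (simp add: K_def s_def)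
  obtain u0 where u0: "u0 \<in> K" "\<And>y. y \<in> K \<Longrightarrow> sens y \<le> sens u0"
    using continuous_attains_sup[OF K _ continuous_on_sens] tK by blast
  define L where "L = K \<inter> {u. sens u = sens u0}"
  have "closed {u :: real^'n. sens u = sens u0}"
    by (intro closed_Collect_eq continuous_on_sens continuous_intros)
  then have "compact L" unfolding L_def by (rule compact_Int_closed[OF K])
  moreover have "u0 \<in> L" using u0 by (simp add: L_def)
  ultimately obtain u where u: "u \<in> L" "\<And>y. y \<in> L \<Longrightarrow> norm u \<le> norm y"
    using continuous_attains_inf[of L norm] continuous_on_norm_id by blast
  have u_nonneg: "u $ k \<ge> 0" and u_sum: "(\<Sum>k\<in>UNIV. u $ k) = s" and u_max: "y \<in> K \<Longrightarrow> sens y \<le> sens u" for k y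
    using u u0 by (auto simp: L_def K_def)
  have eq: "u $ i = u $ j" if ij: "u $ i > 0" "u $ j > 0" for i j
  proof (rule ccontr)
    assume ne: "u $ i \<noteq> u $ j"
    then have inj: "i \<noteq> j" by auto
    define c where "c = (u $ i + u $ j) / 2"
    define z where "z = (u $ i - u $ j) / 2"
    have z: "seg u i j c z = u"
      using inj by (auto simp: seg_def c_def z_def vec_eq_iff field_simps)
    have segK: "seg u i j c y \<in> K" if "\<bar>y\<bar> \<le> c" for y
    proof -
      have "(\<Sum>k\<in>UNIV. seg u i j c y $ k) = (\<Sum>k\<in>UNIV. u $ k)"
        using sum_two_change[of i j "\<lambda>k. seg u i j c y $ k" "\<lambda>k. u $ k"] inj
        by (simp add: seg_def c_def)
      then show ?thesis
        using u_nonneg that u_sum by (auto simp: K_def seg_def)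
    qed
    obtain p q r where r: "r \<ge> 0" and pqr: "\<And>z. sens (seg u i j c z) = p + q * z^2 + r * z^4"
      using sens_seg[OF inj, of u c] by blast
    have c0: "c > 0" using ij by (simp add: c_def)
    \<comment> \<open>The maximizer u is compared with the midpoint, where the two coordinates
      agree, and with the end of the segment, where coordinate j vanishes.\<close>
    have "sens (seg u i j c 0) \<le> sens (seg u i j c z)" "sens (seg u i j c c) \<le> sens (seg u i j c z)"
      using u_max segK c0 by (auto simp: z)
    then have "p \<le> p + q * z^2 + r * (z^2)^2" "p + q * c^2 + r * (c^2)^2 \<le> p + q * z^2 + r * (z^2)^2"
      by (simp_all add: pqr)
    moreover have "0 < z^2" using ne by (simp add: z_def)
    \<comment> \<open>Positivity of both coordinates puts u strictly between these two
      points.\<close>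
    moreover have "c^2 - z^2 = u $ i * u $ j"
      by (simp add: z_def c_def field_simps power2_eq_square)
    then have "z^2 < c^2"
      using mult_pos_pos[OF ij] by simp
    ultimately have "p + q * z^2 + r * (z^2)^2 = p"
      using r by (intro convex_quadratic_interior_max[of r "z^2" "c^2"])
    then have "sens (seg u i j c 0) = sens u"
      using pqr[of z] pqr[of 0] by (simp add: z)
    then have "seg u i j c 0 \<in> L"
      using segK[of 0] c0 u(1) by (auto simp: L_def)
    then have "norm u \<le> norm (seg u i j c 0)" by (rule u(2))
    then have "(norm u)^2 \<le> (norm (seg u i j c 0))^2" by (simp add: power_mono)
    moreover have "(norm v)^2 = (\<Sum>k\<in>UNIV. (v $ k)^2)" for v :: "real^'n"
      by (simp add: norm_vec_def L2_set_def sum_nonneg)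
    moreover have "(\<Sum>k\<in>UNIV. (seg u i j c 0 $ k)^2) = (\<Sum>k\<in>UNIV. (u $ k)^2) + (c^2 + c^2 - (u $ i)^2 - (u $ j)^2)"
      using sum_two_change[of i j "\<lambda>k. (seg u i j c 0 $ k)^2" "\<lambda>k. (u $ k)^2"] inj
      by (simp add: seg_def)
    moreover have "c^2 + c^2 - (u $ i)^2 - (u $ j)^2 = - 2 * z^2"
      by (simp add: c_def z_def field_simps power2_eq_square)
    ultimately show False using \<open>0 < z^2\<close> by simp
  qed
  define A where "A = {i. u $ i > 0}"
  \<comment> \<open>By \<open>eq\<close> all positive coordinates agree, so any choice of index in A
    gives the same value; for empty A the point is 0 and a is set to 0.\<close>
  define a where "a = (if A = {} then 0 else u $ (SOME i. i \<in> A))"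
  have "u $ i = (if i \<in> A then a else 0)" for i
  proof (cases "i \<in> A")
    case True
    then have "(SOME i. i \<in> A) \<in> A" by (rule someI)
    then have "u $ (SOME i. i \<in> A) = u $ i" using True eq by (auto simp: A_def)
    then show ?thesis using True by (auto simp: a_def)
  next
    case False
    then show ?thesis using u_nonneg[of i] by (simp add: A_def)
  qed
  then have uA: "u = (\<chi> i. if i \<in> A then a else 0)" by (simp add: vec_eq_iff)
  show thesis
  proof
    show "a \<ge> 0" using u_nonneg by (simp add: a_def)
    have "(\<Sum>i\<in>UNIV. u $ i) = real (card A) * a" by (simp add: uA sum.If_cases)
    then show "real (card A) * a = (\<Sum>i\<in>UNIV. t $ i)" using u_sum by (simp add: s_def)
    show "sens t \<le> sens (\<chi> i. if i \<in> A then a else 0)" using u_max[OF tK] by (simp add: uA)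
  qed
qed

lemma sens_le_exp:
  fixes t :: "real^'n::finite"
  assumes "\<And>i. t $ i \<ge> 0"
  shows "sens t \<le> exp (2 * (\<Sum>i\<in>UNIV. t $ i))"
proof -
  obtain A :: "'n set" and a where "a \<ge> 0" "real (card A) * a = (\<Sum>i\<in>UNIV. t $ i)"
      "sens t \<le> sens (\<chi> i. if i \<in> A then a else 0)"
    using sens_max_equal_coords[OF assms] by blast
  then show ?thesis
    using equal_coords_bound[of a "card A"] by (simp add: sens_indicator)
qed

subsection \<open>Optimality\<close>

text \<open>The arithmetic-geometric mean inequality in normalized form, obtained by multiplying y
  <= exp (y - 1) over I.\<close>

lemma prod_le_one_if_sum_le_card:
  fixes y :: "'a \<Rightarrow> real"
  assumes "finite I" "\<And>i. i \<in> I \<Longrightarrow> y i \<ge> 0" "sum y I \<le> real (card I)"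
  shows "prod y I \<le> 1"
proof -
  have "prod y I \<le> (\<Prod>i\<in>I. exp (y i - 1))"
    using assms(2) exp_ge_add_one_self[of "y _ - 1"] by (intro prod_mono) auto
  also have "\<dots> = exp (sum y I - real (card I))"
    using assms(1) by (simp add: exp_sum[symmetric] sum_subtractf)
  also have "\<dots> \<le> 1"
    using assms(3) by simp
  finally show ?thesis .
qed

lemma real_card_idx:
  "real (card (idx :: 'n::finite set set)) = 1 + real CARD('n) + real CARD('n) * (real CARD('n) - 1) / 2
     + real CARD('n) * (real CARD('n) - 1) * (real CARD('n) - 2) / 6"
proof -
  have "real (card (idx :: 'n set set)) = (\<Sum>W | W \<subseteq> (UNIV :: 'n set) \<and> card W \<le> 3. 1)"
    by (simp add: idx_def)
  also have "\<dots> = (\<Sum>j\<le>3. real (CARD('n) choose j) * 1)"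
    by (rule sum_subsets_by_card) simp
  also have "{..3::nat} = {0, 1, 2, 3}" by auto
  finally show ?thesis by (simp add: real_choose_2 real_choose_3)
qed

section \<open>Change to the interpolation basis and comparison of the determinants\<close>

definition node :: "'n::finite set \<Rightarrow> real^'n" where
  "node U = (\<chi> i. if i \<in> U then 2 else 0)"

text \<open>The change of basis behind the congruence of information matrices; the factor 2^|S| from
  x = 2t is absorbed into the values at the nodes.\<close>

lemma regf_interpolation:
  fixes x :: "real^'n::finite"
  assumes "S \<in> idx"
  shows "regf x S = (\<Sum>U\<in>idx. regf (node U) S * lag U ((1/2) *\<^sub>R x))"
proof -
  have "regf x S = (\<Prod>i\<in>S. 2 * ((1/2) *\<^sub>R x) $ i)" by (simp add: regf_def)
  also have "\<dots> = 2 ^ card S * regf ((1/2) *\<^sub>R x) S"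
    unfolding regf_def by (subst prod.distrib) simp
  also have "\<dots> = (\<Sum>U\<in>idx. 2 ^ card S * (if S \<subseteq> U then lag U ((1/2) *\<^sub>R x) else 0))"
    by (simp only: regf_eq_sum_lag[OF assms] sum_distrib_left)
  also have "\<dots> = (\<Sum>U\<in>idx. regf (node U) S * lag U ((1/2) *\<^sub>R x))"
    by (intro sum.cong) (auto simp: node_def regf_indicator)
  finally show ?thesis .
qed

lemma intensity_main_effects:
  fixes x :: "real^'n::finite"
  shows "intensity (\<lambda>S. if card S = 1 then -1 else 0) x = exp (- (\<Sum>i\<in>UNIV. x $ i))"
proof -
  have "(\<Sum>S\<in>idx. regf x S * (if card S = 1 then -1 else 0))
      = (\<Sum>S\<in>range (\<lambda>i. {i}). - regf x S)"
    by (rule sum.mono_neutral_cong_right) (auto simp: idx_def card_1_singleton_iff)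
  also have "\<dots> = - (\<Sum>i\<in>UNIV. x $ i)"
    by (subst sum.reindex) (auto simp: regf_def sum_negf inj_on_def)
  finally show ?thesis by (simp add: intensity_def)
qed

theorem theorem6:
  fixes \<beta> :: "'n::finite set \<Rightarrow> real"
  assumes "CARD('n) \<ge> 3"
    and "\<beta> = (\<lambda>S. if card S = 1 then -1 else 0)"
  shows "locally_D_optimal \<beta> {x :: real^'n. \<forall>i. x $ i \<ge> 0}
           ((\<lambda>S. \<chi> i. if i \<in> S then 2 else 0) ` (idx :: 'n set set))
           (\<lambda>_. 1 / (1 + real CARD('n) + real CARD('n) * (real CARD('n) - 1) / 2
                   + real CARD('n) * (real CARD('n) - 1) * (real CARD('n) - 2) / 6))"
proof -
  define I where "I = (idx :: 'n set set)"
  define p where "p = real (card I)"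
  define X where "X = {x :: real^'n. \<forall>i. x $ i \<ge> 0}"
  define F where "F = (\<lambda>U S. regf (node U :: real^'n) S)"
  define \<mu> where "\<mu> = (\<lambda>U :: 'n set. intensity \<beta> (node U))"
  have "{} \<in> I" by (simp add: I_def idx_def)
  then have p: "p > 0" by (auto simp: p_def card_gt_0_iff)
  have inj: "inj_on node I"
    by (rule inj_onI) (auto simp: node_def vec_eq_iff split: if_splits)
  have \<mu>: "\<mu> U = 1 / exp 2 ^ card U" for U
    unfolding \<mu>_def assms(2) intensity_main_effects
    by (simp add: node_def sum.If_cases exp_minus exp_of_nat_mult[symmetric] field_simps)
  have \<mu>_pos: "\<mu> U > 0" for U by (simp add: \<mu>)
  \<comment> \<open>The information matrix of a design in the basis of interpolation
    polynomials.\<close>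
  define N where "N = (\<lambda>D w U V. \<Sum>x\<in>D. w x * intensity \<beta> x * lag U ((1/2) *\<^sub>R x) * lag V ((1/2) *\<^sub>R x))"
  have design: "is_design X (node ` I) (\<lambda>_. 1 / p)"
  proof -
    have "finite (node ` I)" "node ` I \<noteq> {}" "node ` I \<subseteq> X"
      using \<open>{} \<in> I\<close> by (auto simp: X_def node_def)
    moreover have "(\<Sum>x\<in>node ` I. 1 / p) = 1"
      using p by (simp add: card_image[OF inj] p_def[symmetric])
    ultimately show ?thesis
      using p by (simp add: is_design_def)
  qed
  have opt: "det_on I (info_matrix \<beta> (node ` I) (\<lambda>_. 1 / p)) = (det_on I F)^2 * (\<Prod>U\<in>I. \<mu> U / p)"
  proof -
    \<comment> \<open>For the proposed design the sum over its support is already a congruence of a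
      diagonal matrix by F.\<close>
    have "info_matrix \<beta> (node ` I) (\<lambda>_. 1 / p) S T
        = (\<Sum>U\<in>I. \<Sum>V\<in>I. F U S * (if U = V then \<mu> U / p else 0) * F V T)" for S T
    proof -
      have "info_matrix \<beta> (node ` I) (\<lambda>_. 1 / p) S T = (\<Sum>U\<in>I. F U S * (\<mu> U / p) * F U T)"
        unfolding info_matrix_def F_def \<mu>_def sum.reindex[OF inj] by (simp add: mult_ac)
      also have "\<dots> = (\<Sum>U\<in>I. \<Sum>V\<in>I. if U = V then F U S * (\<mu> U / p) * F V T else 0)"
        by simp
      finally show ?thesis
        by (simp add: if_distrib[of "\<lambda>x. _ * x"] if_distrib[of "\<lambda>x. x * _"] cong: if_cong)
    qed
    then have "det_on I (info_matrix \<beta> (node ` I) (\<lambda>_. 1 / p))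
       = (det_on I F)^2 * det_on I (\<lambda>U V. if U = V then \<mu> U / p else 0)"
      by (intro det_on_congruence)
    then show ?thesis by (simp add: det_on_diagonal)
  qed
  have bound: "det_on I (info_matrix \<beta> D w) \<le> (det_on I F)^2 * (\<Prod>U\<in>I. \<mu> U / p)"
    if "is_design X D w" for D w
  proof -
    have D: "finite D" "D \<subseteq> X" "\<And>x. x \<in> D \<Longrightarrow> w x \<ge> 0" "sum w D = 1"
      using that by (auto simp: is_design_def)
    have int_pos: "intensity \<beta> x > 0" for x by (simp add: intensity_def)
    have "info_matrix \<beta> D w S T = (\<Sum>U\<in>I. \<Sum>V\<in>I. F U S * N D w U V * F V T)"
      if "S \<in> I" "T \<in> I" for S T
    proof -
      have "info_matrix \<beta> D w S T = (\<Sum>x\<in>D. \<Sum>U\<in>I. \<Sum>V\<in>I.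
          F U S * (w x * intensity \<beta> x * lag U ((1/2) *\<^sub>R x) * lag V ((1/2) *\<^sub>R x)) * F V T)"
        unfolding info_matrix_def
      proof (rule sum.cong[OF refl])
        fix x
        show "w x * intensity \<beta> x * regf x S * regf x T = (\<Sum>U\<in>I. \<Sum>V\<in>I.
          F U S * (w x * intensity \<beta> x * lag U ((1/2) *\<^sub>R x) * lag V ((1/2) *\<^sub>R x)) * F V T)"
          using that unfolding I_def F_def
          by (subst (1 2) regf_interpolation) (simp_all add: sum_product sum_distrib_left sum_distrib_right mult_ac)
      qed
      also have "\<dots> = (\<Sum>U\<in>I. \<Sum>V\<in>I. \<Sum>x\<in>D.
          F U S * (w x * intensity \<beta> x * lag U ((1/2) *\<^sub>R x) * lag V ((1/2) *\<^sub>R x)) * F V T)"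
        by (subst sum.swap, intro sum.cong refl, rule sum.swap)
      finally show ?thesis
        by (simp add: N_def sum_distrib_left sum_distrib_right)
    qed
    then have "det_on I (info_matrix \<beta> D w) = (det_on I F)^2 * det_on I (N D w)"
      by (rule det_on_congruence)
    moreover have "det_on I (N D w) \<le> (\<Prod>U\<in>I. N D w U U)"
    proof (rule det_on_le_prod_diag)
      show "N D w U V = N D w V U" for U V by (simp add: N_def mult_ac)
      fix v :: "'n set \<Rightarrow> real"
      have "(\<Sum>U\<in>I. \<Sum>V\<in>I. v U * N D w U V * v V)
          = (\<Sum>U\<in>I. \<Sum>V\<in>I. \<Sum>x\<in>D. w x * intensity \<beta> x * (v U * lag U ((1/2) *\<^sub>R x)) * (v V * lag V ((1/2) *\<^sub>R x)))"
        by (simp add: N_def sum_distrib_left sum_distrib_right mult_ac)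
      also have "\<dots> = (\<Sum>x\<in>D. \<Sum>U\<in>I. \<Sum>V\<in>I. w x * intensity \<beta> x * (v U * lag U ((1/2) *\<^sub>R x)) * (v V * lag V ((1/2) *\<^sub>R x)))"
        by (subst (2) sum.swap, intro sum.cong refl, rule sum.swap)
      also have "\<dots> = (\<Sum>x\<in>D. w x * intensity \<beta> x * (\<Sum>U\<in>I. v U * lag U ((1/2) *\<^sub>R x))^2)"
        by (simp add: power2_eq_square sum_product sum_distrib_left mult_ac)
      also have "\<dots> \<ge> 0"
        using D(3) int_pos by (intro sum_nonneg mult_nonneg_nonneg) (auto intro: less_imp_le)
      finally show "(\<Sum>U\<in>I. \<Sum>V\<in>I. v U * N D w U V * v V) \<ge> 0" .
    qed
    moreover have "(\<Prod>U\<in>I. N D w U U) \<le> (\<Prod>U\<in>I. \<mu> U / p)"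
    proof -
      \<comment> \<open>The ratio of a diagonal entry to the corresponding entry
        \<open>\<mu> U / p\<close> of the proposed design; the mean inequality then needs the ratios
        to sum to at most p.\<close>
      define y where "y = (\<lambda>U. N D w U U / \<mu> U * p)"
      have N_nonneg: "N D w U U \<ge> 0" for U
        unfolding N_def
      proof (rule sum_nonneg)
        fix x assume "x \<in> D"
        then have "0 \<le> (w x * intensity \<beta> x) * (lag U ((1/2) *\<^sub>R x))^2"
          using D(3) int_pos[of x] by (intro mult_nonneg_nonneg) (auto intro: less_imp_le)
        then show "0 \<le> w x * intensity \<beta> x * lag U ((1/2) *\<^sub>R x) * lag U ((1/2) *\<^sub>R x)"
          by (simp add: power2_eq_square mult.assoc)
      qed
      \<comment> \<open>Since \<open>1 / \<mu> U\<close> is the weight of U in \<open>sens\<close>,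
        the normalized trace is the design average of intensity times \<open>sens\<close>.\<close>
      have "(\<Sum>U\<in>I. N D w U U / \<mu> U) = (\<Sum>U\<in>I. \<Sum>x\<in>D. w x * (intensity \<beta> x * (exp 2 ^ card U * (lag U ((1/2) *\<^sub>R x))^2)))"
        by (simp add: N_def \<mu> sum_distrib_left power2_eq_square mult_ac)
      also have "\<dots> = (\<Sum>x\<in>D. \<Sum>U\<in>I. w x * (intensity \<beta> x * (exp 2 ^ card U * (lag U ((1/2) *\<^sub>R x))^2)))"
        by (rule sum.swap)
      also have "\<dots> = (\<Sum>x\<in>D. w x * (intensity \<beta> x * sens ((1/2) *\<^sub>R x)))"
        by (simp add: sens_def I_def sum_distrib_left)
      also have "\<dots> \<le> (\<Sum>x\<in>D. w x * 1)"
      proof (intro sum_mono mult_left_mono D(3))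
        fix x assume "x \<in> D"
        then have "x $ i \<ge> 0" for i using D(2) by (auto simp: X_def)
        \<comment> \<open>Passing to x / 2 cancels the factor 2 in the exponent of
          \<open>sens_le_exp\<close>, leaving exactly the reciprocal of the intensity.\<close>
        then have "sens ((1/2) *\<^sub>R x) \<le> exp (\<Sum>i\<in>UNIV. x $ i)"
          using sens_le_exp[of "(1/2) *\<^sub>R x"] by (simp add: sum_divide_distrib[symmetric])
        then have "intensity \<beta> x * sens ((1/2) *\<^sub>R x) \<le> intensity \<beta> x * exp (\<Sum>i\<in>UNIV. x $ i)"
          using int_pos[of x] by simp
        also have "\<dots> = 1"
          unfolding assms(2) intensity_main_effects by (simp add: exp_minus)
        finally show "intensity \<beta> x * sens ((1/2) *\<^sub>R x) \<le> 1" .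
      qed
      finally have "(\<Sum>U\<in>I. N D w U U / \<mu> U) \<le> 1" using D(4) by simp
      moreover have "sum y I = (\<Sum>U\<in>I. N D w U U / \<mu> U) * p"
        unfolding y_def by (rule sum_distrib_right[symmetric])
      ultimately have "sum y I \<le> p"
        using p by (simp add: mult_le_cancel_right1)
      moreover have "y U \<ge> 0" for U
        using N_nonneg[of U] \<mu>_pos[of U] p by (simp add: y_def)
      ultimately have "prod y I \<le> 1"
        by (intro prod_le_one_if_sum_le_card) (auto simp: p_def)
      then have "prod y I * (\<Prod>U\<in>I. \<mu> U / p) \<le> 1 * (\<Prod>U\<in>I. \<mu> U / p)"
        using \<mu>_pos p by (intro mult_right_mono prod_nonneg) (auto intro: less_imp_le)
      moreover have "(\<Prod>U\<in>I. N D w U U) = prod y I * (\<Prod>U\<in>I. \<mu> U / p)"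
        unfolding prod.distrib[symmetric] using \<mu>_pos p
        by (intro prod.cong) (auto simp: y_def less_imp_neq[THEN not_sym])
      ultimately show ?thesis by simp
    qed
    ultimately show ?thesis
      by (simp add: mult_left_mono)
  qed
  have "locally_D_optimal \<beta> X (node ` I) (\<lambda>_. 1 / p)"
    unfolding locally_D_optimal_def
    using design bound opt by (simp add: I_def)
  then show ?thesis
    by (simp only: X_def I_def p_def real_card_idx node_def[abs_def])
qed

end
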